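(* Let $p,q\in[1,\infty]$ be such that $\frac1p+\frac1q=1$. Let $(z_n)_{n\ge1}\in\ell^p(\mathbb{C})$ be a sequence of distinct complex numbers such that $z_n\to0$ and $z_n\ne0$ for all $n$. Let $V$ be the infinite Vandermonde matrix with generators $z_n$, i.e. $V_{ij}=z_j^i$ for $i,j\ge1$. If $\boldsymbol{x}=(x_j)_{j\ge1}\in\ell^q(\mathbb{C})$ satisfies the infinite system of equations $V\boldsymbol{x}=0$, then $\boldsymbol{x}=0$.
   Context: The equation $V\boldsymbol{x}=0$ means that for every integer $i\ge1$, $\sum_{j=1}^\infty z_j^i x_j=0$; this series converges absolutely by Hölder's inequality. *)

theory Defs
  imports "HOL-Analysis.Analysis"
begin

text \<open>
  Sequences \<open>(x\<^sub>n)\<close> with \<open>n \<ge> 1\<close> are functions on \<^typ>\<open>nat\<close> whose value at \<open>0\<close> is irrelevant;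
  an infinite matrix is likewise a function of two indices, both \<open>\<ge> 1\<close>.  Series over
  \<open>j \<ge> 1\<close> are therefore written with \<^const>\<open>Suc\<close>.
\<close>

definition lp_space :: "ennreal \<Rightarrow> (nat \<Rightarrow> complex) set" where
  "lp_space p =
     (if p = \<infinity> then {x. bounded (x ` {1..})}
      else {x. summable (\<lambda>n. norm (x (Suc n)) powr enn2real p)})"

definition inf_vandermonde :: "(nat \<Rightarrow> complex) \<Rightarrow> nat \<Rightarrow> nat \<Rightarrow> complex" where
  "inf_vandermonde z i j = z j ^ i"

text \<open>The infinite system \<open>A x = b\<close>: every row series converges to the right-hand side.\<close>

definition solves_inf_system ::
    "(nat \<Rightarrow> nat \<Rightarrow> complex) \<Rightarrow> (nat \<Rightarrow> complex) \<Rightarrow> (nat \<Rightarrow> complex) \<Rightarrow> bool" where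
  "solves_inf_system A x b \<longleftrightarrow> (\<forall>i\<ge>1. (\<lambda>j. A i (Suc j) * x (Suc j)) sums b i)"

end

theory Submission
  imports Defs "HOL-Computational_Algebra.Polynomial"
begin

text \<open>
  By Young's inequality \<open>c\<^sub>j = z\<^sub>j x\<^sub>j\<close> is absolutely summable, and the system says that the functional
  \<open>P \<mapsto> \<Sum>\<^sub>j c\<^sub>j P(z\<^sub>j)\<close> vanishes on all polynomials.  To isolate \<open>c\<^sub>m\<close>, test it on
  \<open>P(t) = t^k Q(t)\<close>, where \<open>Q\<close> has as roots the finitely many \<open>z\<^sub>j \<noteq> z\<^sub>m\<close> with
  \<open>\<bar>z\<^sub>j\<bar> \<ge> \<bar>z\<^sub>m\<bar>/2\<close>: the \<open>m\<close>-th term has modulus \<open>\<bar>c\<^sub>m Q(z\<^sub>m)\<bar> \<bar>z\<^sub>m\<bar>^k\<close> while all others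
  together are \<open>O((\<bar>z\<^sub>m\<bar>/2)^k)\<close>.
\<close>

lemma moments_zero_imp_poly_zero:
  fixes a c :: "nat \<Rightarrow> complex"
  assumes "\<And>k. (\<lambda>j. c j * a j ^ k) sums 0"
  shows "(\<lambda>j. c j * poly P (a j)) sums 0"
proof -
  have "(\<lambda>j. \<Sum>i\<le>degree P. coeff P i * (c j * a j ^ i)) sums (\<Sum>i\<le>degree P. coeff P i * 0)"
    by (intro sums_sum sums_mult assms)
  then show ?thesis
    by (simp add: poly_altdef sum_distrib_left mult_ac)
qed

lemma moments_zero_imp_zero:
  fixes a c :: "nat \<Rightarrow> complex"
  assumes inj: "inj a" and lim: "a \<longlonglongrightarrow> 0" and summ: "summable (\<lambda>j. norm (c j))"
    and moments: "\<And>k. (\<lambda>j. c j * a j ^ k) sums 0" and nz: "a m \<noteq> 0"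
  shows "c m = 0"
proof -
  define r where "r = norm (a m)"
  have r: "r > 0" using nz by (simp add: r_def)
  \<comment> \<open>Leaving \<open>m\<close> out of \<open>T\<close> and using injectivity keeps
    \<open>poly Q (a m)\<close> nonzero. The threshold \<open>r / 2\<close> gives the decay ratio
    \<open>1/2\<close>.\<close>
  define T where "T = {j. j \<noteq> m \<and> norm (a j) \<ge> r / 2}"
  have "\<forall>\<^sub>F j in sequentially. norm (a j) < r / 2"
    using lim r order_tendstoD(2)[OF tendsto_norm_zero[OF lim], of "r/2"] by simp
  then obtain N where N: "\<And>j. j \<ge> N \<Longrightarrow> norm (a j) < r / 2"
    by (auto simp: eventually_sequentially)
  have "T \<subseteq> {..<N}"
    using N by (force simp: T_def not_le[symmetric])
  then have finT: "finite T" by (rule finite_subset) simp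
  define Q where "Q = (\<Prod>i\<in>T. [:- a i, 1:])"
  have Q_m: "poly Q (a m) \<noteq> 0"
    using finT inj by (auto simp: Q_def poly_prod T_def inj_eq)
  have Q_T: "poly Q (a j) = 0" if "j \<in> T" for j
    using finT that by (auto simp: Q_def poly_prod)
  have "(\<lambda>j. poly Q (a j)) \<longlonglongrightarrow> poly Q 0"
    by (intro tendsto_poly lim)
  \<comment> \<open>A convergent sequence is bounded, so \<open>C\<close> is uniform in
    \<open>j\<close> and does not depend on \<open>k\<close>.\<close>
  then have "Bseq (\<lambda>j. poly Q (a j))"
    using Bseq_conv_Bfun convergentI convergent_imp_Bseq by blast
  then obtain C where C: "C > 0" "\<And>j. norm (poly Q (a j)) \<le> C"
    by (auto simp: Bseq_def)
  define S where "S = (\<Sum>j. norm (c j))"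
  have bound: "norm (c m * poly Q (a m)) \<le> C * S * (1/2) ^ k" for k
  proof -
    define f where "f j = c j * poly (monom 1 k * Q) (a j)" for j
    \<comment> \<open>Removing the \<open>m\<close>-th term from a series with sum 0 leaves one with
      sum \<open>- f m\<close>, so bounding \<open>g\<close> bounds \<open>f m\<close>.\<close>
    define g where "g j = (if j = m then 0 else f j)" for j
    have "f sums 0"
      unfolding f_def by (rule moments_zero_imp_poly_zero[OF moments])
    then have "(\<lambda>j. f j - (if j = m then f j else 0)) sums (0 - f m)"
      by (intro sums_diff sums_single)
    also have "(\<lambda>j. f j - (if j = m then f j else 0)) = g"
      by (auto simp: g_def)
    finally have g: "g sums (- f m)" by simp
    have g_le: "norm (g j) \<le> C * (r/2) ^ k * norm (c j)" for j
    \<comment> \<open>The term vanishes by definition of \<open>g\<close> at \<open>m\<close> and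
      because of the roots of \<open>Q\<close> on \<open>T\<close>; elsewhere
      \<open>norm (a j)\<close> is below \<open>r / 2\<close>.\<close>
    proof (cases "j = m \<or> j \<in> T")
      case True
      then show ?thesis using C r Q_T by (auto simp: g_def f_def)
    next
      case False
      then have "norm (a j) \<le> r / 2" by (auto simp: T_def)
      then have "norm (a j) ^ k * norm (poly Q (a j)) \<le> (r/2) ^ k * C"
        using C r by (intro mult_mono power_mono) auto
      then have "norm (c j) * (norm (a j) ^ k * norm (poly Q (a j))) \<le> norm (c j) * ((r/2) ^ k * C)"
        by (rule mult_left_mono) simp
      then show ?thesis
        using False by (simp add: g_def f_def norm_mult norm_power poly_monom mult_ac)
    qed
    have "norm (- f m) \<le> (\<Sum>j. C * (r/2) ^ k * norm (c j))"
      using norm_suminf_le[of g, OF g_le summable_mult[OF summ]] sums_unique[OF g] by simp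
    also have "\<dots> = r ^ k * (C * S * (1/2) ^ k)"
      using suminf_mult[OF summ, of "C * (r/2) ^ k"] by (simp add: S_def power_divide field_simps)
    finally have "r ^ k * norm (c m * poly Q (a m)) \<le> r ^ k * (C * S * (1/2) ^ k)"
      by (simp add: f_def norm_mult norm_power poly_monom r_def mult_ac)
    then show ?thesis using r by (simp add: mult_le_cancel_left_pos)
  qed
  \<comment> \<open>The left side of \<open>bound\<close> is free of \<open>k\<close>, so letting
    \<open>k\<close> tend to infinity forces it to 0.\<close>
  have "(\<lambda>k. C * S * (1/2) ^ k) \<longlonglongrightarrow> 0"
    by (rule tendsto_mult_right_zero) (simp add: LIMSEQ_realpow_zero)
  then have "norm (c m * poly Q (a m)) \<le> 0"
    by (rule LIMSEQ_le_const) (use bound in blast)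
  then show ?thesis using Q_m by simp
qed

text \<open>The endpoint case of Hoelder, where Young's inequality does not apply.\<close>

lemma summable_mult_bounded:
  fixes u v :: "nat \<Rightarrow> complex"
  assumes "u \<in> lp_space \<infinity>" "v \<in> lp_space 1"
  shows "summable (\<lambda>n. norm (u (Suc n) * v (Suc n)))"
proof -
  obtain B where B: "\<And>n. n \<ge> 1 \<Longrightarrow> norm (u n) \<le> B"
    using assms(1) by (auto simp: lp_space_def bounded_iff)
  have "summable (\<lambda>n. norm (v (Suc n)))"
    using assms(2) by (simp add: lp_space_def)
  then have "summable (\<lambda>n. B * norm (v (Suc n)))"
    by (rule summable_mult)
  then show ?thesis
    by (rule summable_comparison_test')
      (auto simp: norm_mult intro!: mult_right_mono B)
qed

text \<open>In \<open>ennreal\<close>, \<open>1 / \<infinity>\<close> is 0 and \<open>1 / 0\<close>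
  is \<open>\<infinity>\<close>, so \<open>1 / q = 1\<close> forces \<open>q\<close> to be a
  positive real.\<close>

lemma conjugate_exponent_infinity:
  fixes q :: ennreal
  assumes "1 / (\<infinity>::ennreal) + 1 / q = 1"
  shows "q = 1"
proof -
  have "1 / q = 1" using assms by simp
  then show ?thesis
  proof (cases q)
    case (real r)
    have "r > 0"
      using \<open>1 / q = 1\<close> real by (cases "r = 0") (auto simp: divide_ennreal_def)
    then have "ennreal (1 / r) = ennreal 1"
      using \<open>1 / q = 1\<close> real divide_ennreal[of 1 r] by simp
    then have "r = 1"
      using \<open>r > 0\<close> by (subst (asm) ennreal_inj) auto
    then show ?thesis using real by simp
  qed simp
qed

text \<open>Only convergence is needed, not Hoelder's norm estimate, so for finite exponents a
  termwise Young bound is enough.\<close>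

lemma lp_space_mult_summable:
  fixes p q :: ennreal
  assumes "1 \<le> p" "1 \<le> q" "1 / p + 1 / q = 1" and u: "u \<in> lp_space p" and v: "v \<in> lp_space q"
  shows "summable (\<lambda>n. norm (u (Suc n) * v (Suc n)))"
proof -
  consider "p = \<infinity>" | "q = \<infinity>" | "p \<noteq> \<infinity>" "q \<noteq> \<infinity>" by blast
  then show ?thesis
  proof cases
    case 1
    then show ?thesis
      using conjugate_exponent_infinity[of q] assms summable_mult_bounded by simp
  next
    case 2
    then show ?thesis
      using conjugate_exponent_infinity[of p] assms summable_mult_bounded[of v u]
      by (simp add: add.commute mult.commute)
  next
    case 3
    define P Q where "P = enn2real p" and "Q = enn2real q"
    have pq: "p = ennreal P" "q = ennreal Q"
      using 3 by (auto simp: P_def Q_def less_top)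
    have "P \<ge> 0" "Q \<ge> 0" by (auto simp: P_def Q_def)
    then have "P \<ge> 1" "Q \<ge> 1" using assms(1,2) by (auto simp: pq)
    have "ennreal (1 / P + 1 / Q) = ennreal 1"
      using assms(3) \<open>P \<ge> 1\<close> \<open>Q \<ge> 1\<close>
      by (simp add: pq ennreal_plus divide_ennreal[symmetric] del: ennreal_1) simp
    then have conj: "1 / P + 1 / Q = 1"
      using \<open>P \<ge> 1\<close> \<open>Q \<ge> 1\<close> by (subst (asm) ennreal_inj) auto
    \<comment> \<open>If one exponent were 1, the reciprocal of the other would be 0, which no real
      number at least 1 allows.\<close>
    have "P > 1" "Q > 1"
      using conj \<open>P \<ge> 1\<close> \<open>Q \<ge> 1\<close> by (auto simp: less_le)
    have "summable (\<lambda>n. norm (u (Suc n)) powr P / P + norm (v (Suc n)) powr Q / Q)"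
      using u v 3 by (intro summable_add summable_divide) (auto simp: lp_space_def P_def Q_def)
    then show ?thesis
      by (rule summable_comparison_test')
        (use \<open>P > 1\<close> \<open>Q > 1\<close> conj in \<open>auto simp: norm_mult intro!: Youngs_inequality\<close>)
  qed
qed

theorem lemma9:
  fixes p q :: ennreal and z x :: "nat \<Rightarrow> complex"
  assumes "1 \<le> p" and "1 \<le> q" and "1 / p + 1 / q = 1"
    and "z \<in> lp_space p"
    and "inj_on z {1..}"
    and "z \<longlonglongrightarrow> 0"
    and "\<forall>n\<ge>1. z n \<noteq> 0"
    and "x \<in> lp_space q"
    and "solves_inf_system (inf_vandermonde z) x (\<lambda>i. 0)"
  shows "\<forall>n\<ge>1. x n = 0"
proof (intro allI impI)
  fix n :: nat
  assume n: "n \<ge> 1"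
  then obtain m where m: "n = Suc m" by (cases n) auto
  \<comment> \<open>The rows start at exponent 1. Absorbing one factor \<open>z (Suc j)\<close> into
    the coefficient turns row \<open>Suc k\<close> into the \<open>k\<close>-th moment, including
    \<open>k = 0\<close>.\<close>
  have "z (Suc m) * x (Suc m) = 0"
  proof (rule moments_zero_imp_zero[where a = "\<lambda>j. z (Suc j)" and c = "\<lambda>j. z (Suc j) * x (Suc j)"])
    show "inj (\<lambda>j. z (Suc j))"
      using assms(5) by (auto simp: inj_on_def)
    show "(\<lambda>j. z (Suc j)) \<longlonglongrightarrow> 0"
      by (rule LIMSEQ_Suc[OF assms(6)])
    show "summable (\<lambda>j. norm (z (Suc j) * x (Suc j)))"
      by (rule lp_space_mult_summable) (fact assms)+
    show "(\<lambda>j. z (Suc j) * x (Suc j) * z (Suc j) ^ k) sums 0" for k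
      using assms(9)[unfolded solves_inf_system_def inf_vandermonde_def, rule_format, of "Suc k"]
      by (simp add: mult_ac)
    show "z (Suc m) \<noteq> 0" using assms(7) by simp
  qed
  then show "x n = 0" using assms(7) m by simp
qed

end
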